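(* $\mathrm{PoS}_\alpha(2n) = \Theta\left(n^{\log_2(1 + 1/(2\alpha))}\right)$; that is, there are absolute constants $0 < c \le C$ such that for every integer $n \ge 1$ and every real $\alpha \ge 1$, $c\, n^{\log_2(1+1/(2\alpha))} \le \mathrm{PoS}_\alpha(2n) \le C\, n^{\log_2(1+1/(2\alpha))}$. In particular, there is a choice of $\alpha = \alpha(n) \ge 1$ with $\alpha(n) = O(\log n)$ (as $n \to \infty$) for which $\mathrm{PoS}_{\alpha(n)}(2n) = O(1)$.
   Context: All graphs $G$ are complete graphs on $2n$ vertices ($n \ge 1$ an integer) with a positive real weight $w(e)$ on every edge $e$. $G$ is metric if $w(x,y)$ equals the weighted shortest-path distance $\mathrm{dist}_G(x,y)$ for every edge $(x,y)$. All matchings are perfect; for a perfect matching $M$ and a vertex $x$, $M(x)$ is the partner of $x$ in $M$. The cost of an edge set $F$ is $c(F) = \sum_{e \in F} w(e)$, and $M^*$ denotes a minimum-cost perfect matching of $G$. For real $\alpha \ge 1$, an edge $(u,v) \notin M$ is $\alpha$-unstable with respect to $M$ if $\alpha \cdot w(u,v) < \min\{w(u,M(u)), w(v,M(v))\}$; a perfect matching $M$ is $\alpha$-stable if it admits no $\alpha$-unstable edge. Define $\mathrm{PoS}_\alpha(G) = \min\{c(M)/c(M^* ) : M \text{ is an } \alpha\text{-stable perfect matching of } G\}$ and $\mathrm{PoS}_\alpha(2n) = \sup\{\mathrm{PoS}_\alpha(G) : G \text{ is metric}, |V(G)| = 2n\}$. *)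

theory Defs
  imports Complex_Main "HOL-Library.Extended_Real" "HOL-Library.Landau_Symbols"
begin

text \<open>
  A weighted complete graph is a vertex set \<open>V\<close> together with a weight function \<open>w\<close> on
  two-element subsets of \<open>V\<close>; values of \<open>w\<close> on other sets are irrelevant.
\<close>

definition edges :: "'a set \<Rightarrow> 'a set set" where
  "edges V = {e. e \<subseteq> V \<and> card e = 2}"

definition weighted_complete_graph :: "'a set \<Rightarrow> ('a set \<Rightarrow> real) \<Rightarrow> bool" where
  "weighted_complete_graph V w \<longleftrightarrow>
     finite V \<and> V \<noteq> {} \<and> even (card V) \<and> (\<forall>e\<in>edges V. 0 < w e)"

definition simple_paths :: "'a set \<Rightarrow> 'a \<Rightarrow> 'a \<Rightarrow> 'a list set" where
  "simple_paths V x y =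
     {xs. xs \<noteq> [] \<and> distinct xs \<and> set xs \<subseteq> V \<and> hd xs = x \<and> last xs = y}"

definition path_weight :: "('a set \<Rightarrow> real) \<Rightarrow> 'a list \<Rightarrow> real" where
  "path_weight w xs = (\<Sum>i<length xs - 1. w {xs ! i, xs ! Suc i})"

definition graph_dist :: "'a set \<Rightarrow> ('a set \<Rightarrow> real) \<Rightarrow> 'a \<Rightarrow> 'a \<Rightarrow> real" where
  "graph_dist V w x y = Min (path_weight w ` simple_paths V x y)"

definition metric_graph :: "'a set \<Rightarrow> ('a set \<Rightarrow> real) \<Rightarrow> bool" where
  "metric_graph V w \<longleftrightarrow> weighted_complete_graph V w \<and>
     (\<forall>x y. {x, y} \<in> edges V \<longrightarrow> w {x, y} = graph_dist V w x y)"

definition perfect_matching :: "'a set \<Rightarrow> 'a set set \<Rightarrow> bool" where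
  "perfect_matching V M \<longleftrightarrow> M \<subseteq> edges V \<and> (\<forall>v\<in>V. \<exists>!e. e \<in> M \<and> v \<in> e)"

definition partner :: "'a set set \<Rightarrow> 'a \<Rightarrow> 'a" where
  "partner M x = (THE y. {x, y} \<in> M)"

definition cost :: "('a set \<Rightarrow> real) \<Rightarrow> 'a set set \<Rightarrow> real" where
  "cost w F = (\<Sum>e\<in>F. w e)"

definition min_cost_matching :: "'a set \<Rightarrow> ('a set \<Rightarrow> real) \<Rightarrow> 'a set set" where
  "min_cost_matching V w = arg_min (cost w) (perfect_matching V)"

definition unstable_edge ::
  "real \<Rightarrow> 'a set \<Rightarrow> ('a set \<Rightarrow> real) \<Rightarrow> 'a set set \<Rightarrow> 'a \<Rightarrow> 'a \<Rightarrow> bool" where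
  "unstable_edge \<alpha> V w M u v \<longleftrightarrow> {u, v} \<in> edges V \<and> {u, v} \<notin> M \<and>
     \<alpha> * w {u, v} < min (w {u, partner M u}) (w {v, partner M v})"

definition stable_matching ::
  "real \<Rightarrow> 'a set \<Rightarrow> ('a set \<Rightarrow> real) \<Rightarrow> 'a set set \<Rightarrow> bool" where
  "stable_matching \<alpha> V w M \<longleftrightarrow>
     perfect_matching V M \<and> (\<nexists>u v. unstable_edge \<alpha> V w M u v)"

text \<open>
  The minimum ranges over a finite set, which for \<open>\<alpha> \<ge> 1\<close> is nonempty: repeatedly picking a
  lightest edge among the unmatched vertices yields an \<open>\<alpha>\<close>-stable perfect matching.
\<close>

definition PoS_graph :: "real \<Rightarrow> 'a set \<Rightarrow> ('a set \<Rightarrow> real) \<Rightarrow> real" where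
  "PoS_graph \<alpha> V w =
     Min ((\<lambda>M. cost w M / cost w (min_cost_matching V w)) ` {M. stable_matching \<alpha> V w M})"

text \<open>
  Vertices are taken from \<open>nat\<close>, which loses nothing up to isomorphism. The supremum is
  formed in \<open>ereal\<close>, so that an unbounded family would give \<open>\<infinity>\<close> rather than
  an unspecified real.
\<close>

definition PoS :: "real \<Rightarrow> nat \<Rightarrow> ereal" where
  "PoS \<alpha> N = Sup {ereal (PoS_graph \<alpha> V w) | (V :: nat set) w. metric_graph V w \<and> card V = N}"

end

theory Submission
  imports Defs "HOL-Computational_Algebra.Primes"
begin

text \<open>
  Upper bound: start from \<open>M\<^sup>*\<close> and repeatedly flip a lightest \<open>\<alpha>\<close>-unstable edge \<open>{u, v}\<close>, replacing
  the two matching edges at \<open>u\<close> and \<open>v\<close> by \<open>{u, v}\<close> and the edge between the former partners.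
  The weights of the flipped edges are nondecreasing, so an inserted edge \<open>{u, v}\<close> is never removed.
  Each remaining edge closes an alternating path, and a flip joins two paths of lengths \<open>l\<^sub>1\<close> and
  \<open>l\<^sub>2\<close> into one of length at most \<open>l\<^sub>1 + l\<^sub>2 + min l\<^sub>1 l\<^sub>2 / \<alpha>\<close>. With \<open>\<theta> = log 2 (1 + 1 / (2 * \<alpha>))\<close> it
  follows that a path with \<open>m\<close> edges of \<open>M\<^sup>*\<close> of total weight \<open>W\<close> has length at most \<open>W * m powr \<theta>\<close>.

  Lower bound: on a line, put two copies of the previous instance side by side, separated by a gap
  slightly shorter than \<open>1 / \<alpha>\<close> times the length of a copy. Every \<open>\<alpha>\<close>-stable matching must match
  across all these gaps, hence also the two outermost points, while \<open>M\<^sup>*\<close> uses unit edges only.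
\<close>

subsection \<open>Perfect matchings and metric graphs\<close>

lemma insert_in_edges_iff: "{a, b} \<in> edges V \<longleftrightarrow> a \<in> V \<and> b \<in> V \<and> a \<noteq> b"
  by (auto simp: edges_def card_insert_if)

lemma edgesE:
  assumes "e \<in> edges V"
  obtains a b where "e = {a, b}" "a \<noteq> b" "a \<in> V" "b \<in> V"
  using assms by (auto simp: edges_def card_2_iff)

lemma finite_edges: "finite V \<Longrightarrow> finite (edges V)"
  by (rule finite_subset[of _ "Pow V"]) (auto simp: edges_def)

text \<open>Viewing a matching as a partition of \<open>V\<close> into pairs turns the gluing and
  the removal of matchings into set algebra; flips are assembled from these two operations.\<close>

lemma perfect_matching_iff:
  "perfect_matching V M \<longleftrightarrow> M \<subseteq> edges V \<and> \<Union>M = V \<and> pairwise disjnt M"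
proof
  assume pm: "perfect_matching V M"
  then have "M \<subseteq> edges V" and ex1: "\<And>v. v \<in> V \<Longrightarrow> \<exists>!e. e \<in> M \<and> v \<in> e"
    by (auto simp: perfect_matching_def)
  moreover from this have "\<Union>M = V"
    by (auto simp: edges_def) (metis UnionI)
  moreover have "pairwise disjnt M"
    unfolding pairwise_def disjnt_iff using ex1 \<open>\<Union>M = V\<close> by blast
  ultimately show "M \<subseteq> edges V \<and> \<Union>M = V \<and> pairwise disjnt M" by blast
next
  assume "M \<subseteq> edges V \<and> \<Union>M = V \<and> pairwise disjnt M"
  then show "perfect_matching V M"
    unfolding perfect_matching_def pairwise_def disjnt_iff by (metis UnionE)
qed

lemma perfect_matching_unique:
  "perfect_matching V M \<Longrightarrow> e \<in> M \<Longrightarrow> f \<in> M \<Longrightarrow> v \<in> e \<Longrightarrow> v \<in> f \<Longrightarrow> e = f"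
  unfolding perfect_matching_iff pairwise_def disjnt_iff by blast

lemma perfect_matching_subset_edges: "perfect_matching V M \<Longrightarrow> M \<subseteq> edges V"
  by (simp add: perfect_matching_def)

lemma finite_perfect_matching: "finite V \<Longrightarrow> perfect_matching V M \<Longrightarrow> finite M"
  using finite_edges finite_subset perfect_matching_subset_edges by metis

lemma finite_perfect_matchings: "finite V \<Longrightarrow> finite {M. perfect_matching V M}"
  by (rule finite_subset[of _ "Pow (edges V)"])
     (auto simp: finite_edges perfect_matching_def)

lemma card_perfect_matching:
  assumes "finite V" "perfect_matching V M"
  shows "card V = 2 * card M"
proof -
  have "card (\<Union>M) = (\<Sum>e\<in>M. card e)"
    using assms by (intro card_Union_disjoint)
      (auto simp: perfect_matching_iff edges_def intro: finite_subset)
  also have "\<dots> = (\<Sum>e\<in>M. 2)"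
    using assms by (intro sum.cong) (auto simp: perfect_matching_def edges_def)
  finally show ?thesis using assms by (simp add: perfect_matching_iff)
qed

lemma perfect_matching_pair: "a \<noteq> b \<Longrightarrow> perfect_matching {a, b} {{a, b}}"
  by (auto simp: perfect_matching_iff insert_in_edges_iff)

lemma perfect_matching_Un:
  assumes "perfect_matching A M" "perfect_matching B N" "A \<inter> B = {}"
  shows "perfect_matching (A \<union> B) (M \<union> N)"
proof -
  have "M \<union> N \<subseteq> edges (A \<union> B)"
    using assms by (auto simp: perfect_matching_def edges_def)
  moreover have "pairwise disjnt (M \<union> N)"
  proof -
    have "disjnt e f" if "e \<in> M" "f \<in> N" for e f
      using that assms by (auto simp: perfect_matching_iff disjnt_def)
    then show ?thesis
      using assms by (auto simp: perfect_matching_iff pairwise_def disjnt_sym)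
  qed
  ultimately show ?thesis using assms by (auto simp: perfect_matching_iff)
qed

lemma perfect_matching_Diff:
  assumes "perfect_matching V M" "K \<subseteq> M"
  shows "perfect_matching (V - \<Union>K) (M - K)"
proof -
  note dj = perfect_matching_unique[OF assms(1)]
  have "M - K \<subseteq> edges (V - \<Union>K)"
  proof
    fix e assume e: "e \<in> M - K"
    then have "e \<in> edges V" using assms by (auto simp: perfect_matching_def)
    moreover have "e \<inter> \<Union>K = {}" using dj e assms(2) by blast
    ultimately show "e \<in> edges (V - \<Union>K)" by (auto simp: edges_def)
  qed
  moreover have "\<Union>(M - K) = V - \<Union>K"
    using assms dj by (auto simp: perfect_matching_iff)
  moreover have "pairwise disjnt (M - K)"
    using assms unfolding perfect_matching_iff by (meson Diff_subset pairwise_subset)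
  ultimately show ?thesis by (simp add: perfect_matching_iff)
qed

lemma perfect_matching_exists:
  assumes "finite V" "even (card V)"
  shows "\<exists>M. perfect_matching V M"
  using assms
proof (induction "card V" arbitrary: V rule: less_induct)
  case less
  show ?case
  proof (cases "V = {}")
    case True
    then show ?thesis by (intro exI[of _ "{}"]) (simp add: perfect_matching_def)
  next
    case False
    then have "card V \<ge> 2"
      using less.prems by (metis One_nat_def card_0_eq less_2_cases not_less odd_one)
    then obtain S where "S \<subseteq> V" "card S = 2" by (meson obtain_subset_with_card_n)
    then obtain a b where ab: "a \<noteq> b" "a \<in> V" "b \<in> V" by (auto simp: card_2_iff)
    have "card (V - {a, b}) = card V - 2"
      using ab less.prems by (simp add: card_Diff_subset)
    with less.hyps[of "V - {a, b}"] less.prems \<open>card V \<ge> 2\<close>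
    obtain M where "perfect_matching (V - {a, b}) M" by auto
    from perfect_matching_Un[OF perfect_matching_pair[OF ab(1)] this] ab
    show ?thesis by (auto simp: insert_absorb)
  qed
qed

section \<open>Partners and minimum-cost matchings\<close>

context
  fixes V :: "'a set" and M
  assumes pm: "perfect_matching V M"
begin

lemma partner_eq: "{v, y} \<in> M \<Longrightarrow> partner M v = y"
proof -
  assume vy: "{v, y} \<in> M"
  show ?thesis unfolding partner_def
  proof (rule the_equality, rule vy)
    fix z assume vz: "{v, z} \<in> M"
    have "{v, z} \<in> edges V" "{v, y} \<in> edges V" using vy vz pm by (auto simp: perfect_matching_def)
    moreover from this have "{v, y} = {v, z}"
      using vy vz pm unfolding perfect_matching_def insert_in_edges_iff by blast
    ultimately show "z = y" unfolding insert_in_edges_iff by (auto simp: doubleton_eq_iff)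
  qed
qed

lemma partner_edge: "v \<in> V \<Longrightarrow> {v, partner M v} \<in> M"
proof -
  assume "v \<in> V"
  then obtain e where e: "e \<in> M" "v \<in> e" using pm by (auto simp: perfect_matching_iff)
  then have "e \<in> edges V" using pm by (auto simp: perfect_matching_def)
  then obtain y where "e = {v, y}" using e by (elim edgesE) (auto simp: insert_commute)
  then show ?thesis using e partner_eq by simp
qed

lemma partner_in: "v \<in> V \<Longrightarrow> partner M v \<in> V"
  and partner_neq: "v \<in> V \<Longrightarrow> partner M v \<noteq> v"
proof -
  assume "v \<in> V"
  then have "{v, partner M v} \<in> edges V" using partner_edge pm by (auto simp: perfect_matching_def)
  then show "partner M v \<in> V" "partner M v \<noteq> v" unfolding insert_in_edges_iff by auto
qed

lemma partner_partner: "v \<in> V \<Longrightarrow> partner M (partner M v) = v"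
  using partner_edge partner_eq by (simp add: insert_commute)

end

text \<open>\<open>arg_min\<close> is meaningful only where a minimum is attained. Here it is, since
  the perfect matchings form a finite nonempty set.\<close>

lemma min_cost_matching_min:
  assumes "finite V" "even (card V)"
  shows "perfect_matching V (min_cost_matching V w)"
    and "perfect_matching V M \<Longrightarrow> cost w (min_cost_matching V w) \<le> cost w M"
proof -
  let ?S = "{M. perfect_matching V M}"
  have S: "finite ?S" "?S \<noteq> {}"
    using assms finite_perfect_matchings perfect_matching_exists by auto
  have eq: "min_cost_matching V w = arg_min_on (cost w) ?S"
    by (simp add: min_cost_matching_def arg_min_on_def)
  show "perfect_matching V (min_cost_matching V w)"
    using arg_min_if_finite(1)[OF S, of "cost w"] unfolding eq by simp
  show "cost w (min_cost_matching V w) \<le> cost w M" if "perfect_matching V M"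
    using arg_min_least[OF S, of M "cost w"] that unfolding eq by simp
qed

section \<open>Shortest-path metrics\<close>

lemma finite_simple_paths: "finite V \<Longrightarrow> finite (simple_paths V x y)"
  by (rule finite_subset[OF _ finite_subset_distinct[of V]]) (auto simp: simple_paths_def)

text \<open>The path \<open>[x, y, z]\<close> is among those over which \<open>graph_dist\<close>
  minimises.\<close>

lemma metric_graph_triangle:
  assumes mg: "metric_graph V w" and V: "x \<in> V" "y \<in> V" "z \<in> V" and ne: "x \<noteq> y" "y \<noteq> z" "x \<noteq> z"
  shows "w {x, z} \<le> w {x, y} + w {y, z}"
proof -
  have fin: "finite V" using mg by (simp add: metric_graph_def weighted_complete_graph_def)
  have "w {x, z} = graph_dist V w x z"
    using mg V ne by (simp add: metric_graph_def insert_in_edges_iff)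
  also have "\<dots> \<le> path_weight w [x, y, z]"
    unfolding graph_dist_def using V ne fin
    by (intro Min_le finite_imageI finite_simple_paths imageI) (auto simp: simple_paths_def)
  also have "\<dots> = w {x, y} + w {y, z}"
    by (simp add: path_weight_def numeral_2_eq_2)
  finally show ?thesis .
qed

text \<open>By the triangle inequality no path is shorter than the value of \<open>d\<close> at its
  ends, and the one-edge path attains this value.\<close>

lemma metric_graphI:
  fixes d :: "'a \<Rightarrow> 'a \<Rightarrow> real"
  assumes V: "finite V" "V \<noteq> {}" "even (card V)"
    and w: "\<And>x y. x \<in> V \<Longrightarrow> y \<in> V \<Longrightarrow> w {x, y} = d x y"
    and pos: "\<And>x y. x \<in> V \<Longrightarrow> y \<in> V \<Longrightarrow> x \<noteq> y \<Longrightarrow> 0 < d x y"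
    and d0: "\<And>x. x \<in> V \<Longrightarrow> d x x = 0"
    and tri: "\<And>x y z. x \<in> V \<Longrightarrow> y \<in> V \<Longrightarrow> z \<in> V \<Longrightarrow> d x z \<le> d x y + d y z"
  shows "metric_graph V w"
proof -
  have path: "d (hd xs) (last xs) \<le> path_weight w xs" if "xs \<noteq> []" "set xs \<subseteq> V" for xs
    using that
  proof (induction xs rule: list_nonempty_induct)
    case (single x)
    then show ?case by (simp add: path_weight_def d0)
  next
    case (cons x xs)
    from cons have IH: "d (hd xs) (last xs) \<le> path_weight w xs" by simp
    obtain y ys where xs: "xs = y # ys" using cons by (cases xs) auto
    have "d x (last xs) \<le> d x y + d y (last xs)"
      using cons.prems cons.hyps by (intro tri) (auto simp: xs)
    also have "\<dots> \<le> w {x, y} + path_weight w xs"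
      using IH w[of x y] cons.prems by (simp add: xs)
    also have "\<dots> = path_weight w (x # xs)"
      by (simp add: path_weight_def xs sum.lessThan_Suc_shift del: sum.lessThan_Suc)
    finally show ?case using cons.hyps by simp
  qed
  have "w {x, y} = graph_dist V w x y" if xy: "x \<in> V" "y \<in> V" "x \<noteq> y" for x y
    unfolding graph_dist_def
  proof (rule Min_eqI[symmetric])
    show "finite (path_weight w ` simple_paths V x y)"
      using V by (simp add: finite_simple_paths)
    show "w {x, y} \<in> path_weight w ` simple_paths V x y"
      using xy by (intro image_eqI[of _ _ "[x, y]"]) (auto simp: path_weight_def simple_paths_def)
    show "w {x, y} \<le> z" if "z \<in> path_weight w ` simple_paths V x y" for z
      using that path w xy by (auto simp: simple_paths_def)
  qed
  moreover have "0 < w e" if "e \<in> edges V" for e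
    using that w pos by (elim edgesE) auto
  ultimately show ?thesis
    using V by (simp add: metric_graph_def weighted_complete_graph_def insert_in_edges_iff)
qed

subsection \<open>Flipping unstable edges\<close>

text \<open>The AM-GM inequality applied twice: \<open>a * b \<le> 1 / 4\<close>, and the right side
  is at least \<open>2 * (a * b) powr (- \<theta> / 2)\<close>.\<close>

lemma powr_sum_ge_of_sum_eq_1:
  fixes a b \<theta> :: real
  assumes "a > 0" "b > 0" "a + b = 1" "\<theta> \<ge> 0"
  shows "2 * 2 powr \<theta> \<le> a powr (- \<theta>) + b powr (- \<theta>)"
proof -
  have "0 \<le> (a - b)\<^sup>2" by simp
  then have "4 * (a * b) \<le> (a + b)\<^sup>2" by (simp add: power2_eq_square algebra_simps)
  then have ab: "a * b \<le> 1 / 4" using assms by simp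
  have "(1 / 4 :: real) = 2 powr - 2" by (simp add: powr_neg_numeral)
  then have "2 powr \<theta> = (1 / 4) powr (- (\<theta> / 2))" by (simp only: powr_powr) simp
  also have "\<dots> \<le> (a * b) powr (- (\<theta> / 2))"
    using ab assms by (intro powr_mono2') auto
  also have "\<dots> = a powr (- \<theta> / 2) * b powr (- \<theta> / 2)"
    using assms by (simp add: powr_mult)
  finally have "2 * 2 powr \<theta> \<le> 2 * (a powr (- \<theta> / 2) * b powr (- \<theta> / 2))" by simp
  also have "\<dots> \<le> (a powr (- \<theta> / 2))\<^sup>2 + (b powr (- \<theta> / 2))\<^sup>2"
    using sum_squares_bound[of "a powr (- \<theta> / 2)" "b powr (- \<theta> / 2)"] by (simp add: mult.assoc)
  also have "\<dots> = a powr (- \<theta>) + b powr (- \<theta>)"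
    by (simp add: power2_eq_square flip: powr_add)
  finally show ?thesis .
qed

text \<open>The exponent is chosen so that \<open>2 * 2 powr \<theta> = 2 + \<beta>\<close>. The
  right side equals \<open>A * l\<^sub>1 + B * l\<^sub>2\<close> with \<open>A\<close> and
  \<open>B\<close> at least 1 and \<open>A + B \<ge> 2 + \<beta>\<close>. Hence the smaller length
  counts at least \<open>2 + \<beta>\<close> times in total, and the excess of the larger one at
  least once.\<close>

lemma merge_ineq:
  fixes \<beta> W\<^sub>1 W\<^sub>2 m\<^sub>1 m\<^sub>2 :: real
  assumes "0 \<le> \<beta>" "0 \<le> W\<^sub>1" "0 \<le> W\<^sub>2" "0 < m\<^sub>1" "0 < m\<^sub>2" and \<theta>: "\<theta> = log 2 (1 + \<beta> / 2)"
  shows "W\<^sub>1 * m\<^sub>1 powr \<theta> + W\<^sub>2 * m\<^sub>2 powr \<theta> + \<beta> * min (W\<^sub>1 * m\<^sub>1 powr \<theta>) (W\<^sub>2 * m\<^sub>2 powr \<theta>)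
    \<le> (W\<^sub>1 + W\<^sub>2) * (m\<^sub>1 + m\<^sub>2) powr \<theta>"
proof -
  define m where "m = m\<^sub>1 + m\<^sub>2"
  define l\<^sub>1 where "l\<^sub>1 = W\<^sub>1 * m\<^sub>1 powr \<theta>"
  define l\<^sub>2 where "l\<^sub>2 = W\<^sub>2 * m\<^sub>2 powr \<theta>"
  define A where "A = (m\<^sub>1 / m) powr (- \<theta>)"
  define B where "B = (m\<^sub>2 / m) powr (- \<theta>)"
  have m: "0 < m" and m_ge: "m\<^sub>1 \<le> m" "m\<^sub>2 \<le> m" using assms by (simp_all add: m_def)
  have \<theta>0: "0 \<le> \<theta>" using assms by (simp add: \<theta>)
  have "2 * 2 powr \<theta> = 2 + \<beta>" using assms by (simp add: \<theta>)
  moreover have "2 * 2 powr \<theta> \<le> A + B"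
    unfolding A_def B_def using assms m \<theta>0
    by (intro powr_sum_ge_of_sum_eq_1) (auto simp: m_def simp flip: add_divide_distrib)
  ultimately have AB: "2 + \<beta> \<le> A + B" by simp
  have ge1: "1 \<le> (x / m) powr (- \<theta>)" if "0 < x" "x \<le> m" for x
    using powr_mono2'[of "- \<theta>" "x / m" 1] that \<theta>0 m by simp
  have A1: "1 \<le> A" and B1: "1 \<le> B"
    using assms(4,5) unfolding A_def B_def by (simp_all add: ge1 m_ge)
  have l: "0 \<le> l\<^sub>1" "0 \<le> l\<^sub>2" using assms by (auto simp: l\<^sub>1_def l\<^sub>2_def)
  have "(W\<^sub>1 + W\<^sub>2) * m powr \<theta> = A * l\<^sub>1 + B * l\<^sub>2"
    using assms m by (simp add: A_def B_def l\<^sub>1_def l\<^sub>2_def powr_divide powr_minus field_simps)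
  moreover have "l\<^sub>1 + l\<^sub>2 + \<beta> * min l\<^sub>1 l\<^sub>2 \<le> A * l\<^sub>1 + B * l\<^sub>2"
  proof (cases "l\<^sub>1 \<le> l\<^sub>2")
    case True
    have "(2 + \<beta>) * l\<^sub>1 + 1 * (l\<^sub>2 - l\<^sub>1) \<le> (A + B) * l\<^sub>1 + B * (l\<^sub>2 - l\<^sub>1)"
      using mult_right_mono[OF AB l(1)] mult_right_mono[OF B1, of "l\<^sub>2 - l\<^sub>1"] True by linarith
    then show ?thesis using True by (simp add: algebra_simps)
  next
    case False
    have "(2 + \<beta>) * l\<^sub>2 + 1 * (l\<^sub>1 - l\<^sub>2) \<le> (A + B) * l\<^sub>2 + A * (l\<^sub>1 - l\<^sub>2)"
      using mult_right_mono[OF AB l(2)] mult_right_mono[OF A1, of "l\<^sub>1 - l\<^sub>2"] False by linarith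
    then show ?thesis using False by (simp add: algebra_simps)
  qed
  ultimately show ?thesis by (simp add: m_def l\<^sub>1_def l\<^sub>2_def)
qed

section \<open>The flip of an unstable edge\<close>

definition flip_edges :: "'a set set \<Rightarrow> 'a \<Rightarrow> 'a \<Rightarrow> 'a set set" where
  "flip_edges M u v =
     insert {u, v} (insert {partner M u, partner M v}
       (M - {{u, partner M u}, {v, partner M v}}))"

context
  fixes V :: "'a set" and M u v
  assumes pm: "perfect_matching V M" and uv: "u \<in> V" "v \<in> V" "u \<noteq> v" "{u, v} \<notin> M"
begin

lemma flip_distinct:
  shows "partner M u \<noteq> partner M v" "partner M u \<noteq> v" "partner M v \<noteq> u"
    "{u, partner M u} \<noteq> {v, partner M v}"
    "{partner M u, partner M v} \<notin> M"
proof -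
  show 1: "partner M u \<noteq> partner M v" using partner_partner[OF pm] uv by metis
  show 2: "partner M u \<noteq> v" using partner_edge[OF pm, of u] uv by auto
  show 3: "partner M v \<noteq> u" using partner_edge[OF pm, of v] uv by (auto simp: insert_commute)
  show "{u, partner M u} \<noteq> {v, partner M v}" using 2 uv by (auto simp: doubleton_eq_iff)
  show "{partner M u, partner M v} \<notin> M"
    using partner_eq[OF pm, of "partner M u" "partner M v"] partner_partner[OF pm, of u] uv 3 by auto
qed

text \<open>Two old edges are exchanged for two new ones on the same four vertices; the rest of
  \<open>M\<close> matches the remaining vertices perfectly.\<close>

lemma perfect_matching_flip: "perfect_matching V (flip_edges M u v)"
proof -
  let ?K = "{{u, partner M u}, {v, partner M v}}"
  let ?N = "{{u, v}, {partner M u, partner M v}}"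
  have "perfect_matching ({u, v} \<union> {partner M u, partner M v}) ({{u, v}} \<union> {{partner M u, partner M v}})"
    using uv flip_distinct partner_neq[OF pm]
    by (intro perfect_matching_Un perfect_matching_pair) auto
  moreover have "{u, v} \<union> {partner M u, partner M v} = \<Union>?K" by auto
  ultimately have "perfect_matching (\<Union>?K) ?N" by (simp add: insert_commute)
  moreover have K: "?K \<subseteq> M" using partner_edge[OF pm] uv by auto
  then have "perfect_matching (V - \<Union>?K) (M - ?K)" by (rule perfect_matching_Diff[OF pm])
  ultimately have "perfect_matching (\<Union>?K \<union> (V - \<Union>?K)) (?N \<union> (M - ?K))"
    by (rule perfect_matching_Un) auto
  moreover have "\<Union>?K \<union> (V - \<Union>?K) = V"
    using uv partner_in[OF pm] by auto
  moreover have "?N \<union> (M - ?K) = flip_edges M u v" by (auto simp: flip_edges_def)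
  ultimately show ?thesis by simp
qed

lemma partner_flip_cases:
  assumes "a \<in> V"
  shows "partner (flip_edges M u v) a = partner M a \<or> a \<in> {u, v, partner M u, partner M v}"
proof -
  have "{a, partner M a} \<in> flip_edges M u v" if "a \<notin> {u, v, partner M u, partner M v}"
    using that partner_edge[OF pm assms] by (auto simp: flip_edges_def doubleton_eq_iff)
  then show ?thesis using partner_eq[OF perfect_matching_flip] by blast
qed

end

lemma unstable_edgeD:
  assumes "unstable_edge \<alpha> V w M u v"
  shows "u \<in> V" "v \<in> V" "u \<noteq> v" "{u, v} \<notin> M"
    "\<alpha> * w {u, v} < w {u, partner M u}" "\<alpha> * w {u, v} < w {v, partner M v}"
  using assms by (auto simp: unstable_edge_def insert_in_edges_iff)

text \<open>This is why the weights of flipped edges never decrease. A flip changes partners only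
  along matching edges heavier than \<open>\<alpha> * w {u, v}\<close>, so it cannot create an
  unstable edge lighter than \<open>{u, v}\<close>.\<close>

lemma flip_unstable_weight_ge:
  assumes pm: "perfect_matching V M" and \<alpha>: "1 \<le> \<alpha>" and pos: "\<And>e. e \<in> edges V \<Longrightarrow> 0 < w e"
    and un: "unstable_edge \<alpha> V w M u v"
    and least: "\<And>a b. unstable_edge \<alpha> V w M a b \<Longrightarrow> w {u, v} \<le> w {a, b}"
    and un': "unstable_edge \<alpha> V w (flip_edges M u v) a b"
  shows "w {u, v} \<le> w {a, b}"
proof (rule ccontr)
  assume "\<not> w {u, v} \<le> w {a, b}"
  then have less: "w {a, b} < w {u, v}" by simp
  note uv = unstable_edgeD[OF un]
  note ab = unstable_edgeD[OF un']
  \<comment> \<open>A vertex whose partner changes is an endpoint of one of the two removed edges,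
    and instability of \<open>{u, v}\<close> makes both of them heavy.\<close>
  have same: "partner (flip_edges M u v) c = partner M c \<or> \<alpha> * w {u, v} < w {c, partner M c}"
    if "c \<in> V" for c
    using partner_flip_cases[OF pm uv(1-4) that] uv(5,6) partner_partner[OF pm] uv(1,2)
    by (auto simp: insert_commute)
  have lt: "\<alpha> * w {a, b} < \<alpha> * w {u, v}" using less \<alpha> by simp
  have le: "w {u, v} \<le> \<alpha> * w {u, v}"
    using \<alpha> pos[of "{u, v}"] uv by (simp add: insert_in_edges_iff)
  show False
  proof (cases "{a, b} \<in> M")
    \<comment> \<open>Then the flip removed \<open>{a, b}\<close>, so this edge would have to be
      heavier than \<open>\<alpha> * w {u, v}\<close>.\<close>
    case True
    then have "partner M a = b" by (rule partner_eq[OF pm])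
    moreover from this have "partner (flip_edges M u v) a \<noteq> partner M a"
      using ab(4) partner_edge[OF perfect_matching_flip[OF pm uv(1-4)] ab(1)] by auto
    ultimately show False using same[OF ab(1)] less le by auto
  next
    case False
    \<comment> \<open>As \<open>{u, v}\<close> is a lightest unstable edge, \<open>{a, b}\<close>
      was blocked by a matching edge of weight at most \<open>\<alpha> * w {a, b}\<close>. Such an
      edge is too light to be removed, so it still blocks \<open>{a, b}\<close>.\<close>
    have "\<not> unstable_edge \<alpha> V w M a b" using least less by fastforce
    then have "w {a, partner M a} \<le> \<alpha> * w {a, b} \<or> w {b, partner M b} \<le> \<alpha> * w {a, b}"
      using ab False by (auto simp: unstable_edge_def insert_in_edges_iff)
    then show False using same[OF ab(1)] same[OF ab(2)] lt ab(5,6) by auto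
  qed
qed

text \<open>
  Every non-frozen edge \<open>g \<in> M - F\<close> stands for an alternating path made of \<open>m g\<close> edges of the
  initial matching, of total weight \<open>W g\<close>, and of frozen edges; \<open>W g * m g powr \<theta>\<close> bounds its length.
\<close>

lemma stable_matching_flip_induct:
  fixes V :: "'a set" and W m :: "'a set \<Rightarrow> real"
  assumes mg: "metric_graph V w" and \<alpha>: "1 \<le> \<alpha>" and \<theta>: "\<theta> = log 2 (1 + 1 / (2 * \<alpha>))"
    and "perfect_matching V M" "F \<subseteq> M"
    and "\<And>f a b. f \<in> F \<Longrightarrow> unstable_edge \<alpha> V w M a b \<Longrightarrow> w f \<le> w {a, b}"
    and "\<And>g. g \<in> M - F \<Longrightarrow> 0 \<le> W g \<and> 0 < m g \<and> w g \<le> W g * m g powr \<theta>"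
    and "cost w F \<le> (\<Sum>g\<in>M - F. W g * m g powr \<theta>)"
  shows "\<exists>M'. stable_matching \<alpha> V w M' \<and>
    cost w M' \<le> 2 * (\<Sum>g\<in>M - F. W g) * (\<Sum>g\<in>M - F. m g) powr \<theta>"
  using assms(4-)
\<comment> \<open>A flip replaces two non-frozen edges by one, so \<open>M - F\<close>
  shrinks.\<close>
proof (induction "card (M - F)" arbitrary: M F W m rule: less_induct)
  case less
  note pm = less.prems(1) and FM = less.prems(2) and frozen = less.prems(3)
    and Wm = less.prems(4) and costF = less.prems(5)
  have fin: "finite V" and pos: "\<And>e. e \<in> edges V \<Longrightarrow> 0 < w e"
    using mg by (auto simp: metric_graph_def weighted_complete_graph_def)
  have finM: "finite M" by (rule finite_perfect_matching[OF fin pm])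
  have \<theta>0: "0 \<le> \<theta>" unfolding \<theta> using \<alpha> by (subst zero_le_log_cancel_iff) (auto simp: add_pos_nonneg)
  define U where "U = {(a, b). unstable_edge \<alpha> V w M a b}"
  have "finite U" by (rule finite_subset[of _ "V \<times> V"]) (auto simp: U_def fin dest: unstable_edgeD)
  show ?case
  proof (cases "U = {}")
    case True
    then have "stable_matching \<alpha> V w M" using pm by (auto simp: stable_matching_def U_def)
    moreover have "cost w M \<le> 2 * (\<Sum>g\<in>M - F. W g) * (\<Sum>g\<in>M - F. m g) powr \<theta>"
    proof -
      have "cost w M = cost w F + (\<Sum>g\<in>M - F. w g)"
        using sum.subset_diff[OF FM finM, of w] by (simp add: cost_def)
      also have "(\<Sum>g\<in>M - F. w g) \<le> (\<Sum>g\<in>M - F. W g * m g powr \<theta>)"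
        using Wm by (intro sum_mono) auto
      also note costF
      also have "(\<Sum>g\<in>M - F. W g * m g powr \<theta>) \<le> (\<Sum>g\<in>M - F. W g * (\<Sum>g\<in>M - F. m g) powr \<theta>)"
        using Wm finM \<theta>0
        by (intro sum_mono mult_left_mono powr_mono2 member_le_sum) (auto intro: less_imp_le)
      finally show ?thesis by (simp add: sum_distrib_right mult.assoc)
    qed
    ultimately show ?thesis by blast
  next
    case False
    define p where "p = arg_min_on (\<lambda>(a, b). w {a, b}) U"
    obtain u v where p: "p = (u, v)" by (cases p)
    have "p \<in> U" unfolding p_def by (rule arg_min_if_finite(1)[OF \<open>finite U\<close> False])
    then have un: "unstable_edge \<alpha> V w M u v" by (simp add: U_def p)
    have least: "w {u, v} \<le> w {a, b}" if "unstable_edge \<alpha> V w M a b" for a b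
      using arg_min_least[OF \<open>finite U\<close> False, of "(a, b)" "\<lambda>(a, b). w {a, b}"] that
      unfolding p_def[symmetric] p by (simp add: U_def)
    note uv = unstable_edgeD[OF un]
    note dist = flip_distinct[OF pm uv(1-4)]
    define x where "x = partner M u"
    define y where "y = partner M v"
    have V: "x \<in> V" "y \<in> V" "x \<noteq> u" "y \<noteq> v" "x \<noteq> y" "x \<noteq> v" "y \<noteq> u"
      using partner_in[OF pm] partner_neq[OF pm] uv dist by (auto simp: x_def y_def)
    have e: "{u, x} \<in> M" "{v, y} \<in> M" "{u, x} \<noteq> {v, y}" "{x, y} \<notin> M"
      using partner_edge[OF pm] uv dist by (auto simp: x_def y_def)
    have wuv: "0 < w {u, v}" using pos[of "{u, v}"] uv by (simp add: insert_in_edges_iff)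
    have a_le: "w {u, v} \<le> \<alpha> * w {u, v}" using \<alpha> wuv by simp
    \<comment> \<open>Frozen edges weigh at most \<open>w {u, v}\<close>, whereas the two edges to
      be removed weigh more.\<close>
    have nF: "{u, x} \<notin> F" "{v, y} \<notin> F"
      using frozen[OF _ un] a_le uv(5,6) by (fastforce simp: x_def y_def)+
    define M' where "M' = flip_edges M u v"
    define F' where "F' = insert {u, v} F"
    define R where "R = M - F - {{u, x}, {v, y}}"
    \<comment> \<open>The edge \<open>{x, y}\<close> stands for the two old paths joined through
      \<open>{u, v}\<close>, so the weights and the numbers of initial edges add up and their totals
      are preserved.\<close>
    define W' where "W' = W({x, y} := W {u, x} + W {v, y})"
    define m' where "m' = m({x, y} := m {u, x} + m {v, y})"
    have finR: "finite R" using finM by (simp add: R_def)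
    have MF: "M - F = insert {u, x} (insert {v, y} R)" "{u, x} \<notin> insert {v, y} R" "{v, y} \<notin> R"
      using e nF by (auto simp: R_def)
    have "{x, y} \<noteq> {u, v}" using V by (auto simp: doubleton_eq_iff)
    then have MF': "M' - F' = insert {x, y} R" and xyR: "{x, y} \<notin> R"
      using e FM uv(4) by (auto simp: M'_def F'_def flip_edges_def R_def x_def[symmetric] y_def[symmetric])
    have sumMF: "(\<Sum>g\<in>M - F. h g) = h {u, x} + h {v, y} + (\<Sum>g\<in>R. h g)" for h :: "'a set \<Rightarrow> real"
      unfolding MF(1) using finR MF(2,3) by simp
    have sumMF': "(\<Sum>g\<in>M' - F'. h g) = h {x, y} + (\<Sum>g\<in>R. h g)" for h :: "'a set \<Rightarrow> real"
      unfolding MF' using finR xyR by simp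
    have sumR: "(\<Sum>g\<in>R. h (W' g) (m' g)) = (\<Sum>g\<in>R. h (W g) (m g))" for h :: "real \<Rightarrow> real \<Rightarrow> real"
      using xyR by (intro sum.cong) (auto simp: W'_def m'_def)
    have sums: "(\<Sum>g\<in>M' - F'. W' g) = (\<Sum>g\<in>M - F. W g)" "(\<Sum>g\<in>M' - F'. m' g) = (\<Sum>g\<in>M - F. m g)"
      using sumR[of "\<lambda>a b. a"] sumR[of "\<lambda>a b. b"] unfolding sumMF sumMF' by (simp_all add: W'_def m'_def)
    let ?l1 = "W {u, x} * m {u, x} powr \<theta>" and ?l2 = "W {v, y} * m {v, y} powr \<theta>"
    let ?l = "(W {u, x} + W {v, y}) * (m {u, x} + m {v, y}) powr \<theta>"
    have Wm1: "0 \<le> W {u, x}" "0 < m {u, x}" "w {u, x} \<le> ?l1"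
      and Wm2: "0 \<le> W {v, y}" "0 < m {v, y}" "w {v, y} \<le> ?l2"
      using Wm[of "{u, x}"] Wm[of "{v, y}"] MF(1) by auto
    have "w {u, v} \<le> 1 / \<alpha> * min ?l1 ?l2"
      using uv(5,6) Wm1 Wm2 \<alpha> by (simp add: x_def y_def field_simps)
    moreover have "?l1 + ?l2 + 1 / \<alpha> * min ?l1 ?l2 \<le> ?l"
      using \<alpha> Wm1 Wm2 by (intro merge_ineq) (auto simp: \<theta> mult.commute)
    \<comment> \<open>This estimate is used twice: with the triangle inequality it bounds
      \<open>w {x, y}\<close>, and it pays for the newly frozen edge \<open>{u, v}\<close>.\<close>
    ultimately have merge: "?l1 + ?l2 + w {u, v} \<le> ?l" by linarith
    have "w {x, y} \<le> w {x, v} + w {v, y}"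
      using V uv by (intro metric_graph_triangle[OF mg]) auto
    also have "w {x, v} \<le> w {x, u} + w {u, v}"
      using V uv by (intro metric_graph_triangle[OF mg]) auto
    finally have wxy: "w {x, y} \<le> ?l"
      using merge Wm1 Wm2 by (simp add: insert_commute)
    have "\<exists>N. stable_matching \<alpha> V w N \<and>
      cost w N \<le> 2 * (\<Sum>g\<in>M' - F'. W' g) * (\<Sum>g\<in>M' - F'. m' g) powr \<theta>"
    proof (rule less.hyps)
      show "card (M' - F') < card (M - F)"
        unfolding MF' MF(1) using finR xyR MF(2,3) by simp
      show "perfect_matching V M'"
        unfolding M'_def by (rule perfect_matching_flip[OF pm uv(1-4)])
      show "F' \<subseteq> M'"
        using FM nF by (auto simp: M'_def F'_def flip_edges_def x_def[symmetric] y_def[symmetric])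
      show "w f \<le> w {a, b}" if "f \<in> F'" "unstable_edge \<alpha> V w M' a b" for f a b
      proof -
        have "w {u, v} \<le> w {a, b}"
        proof (rule flip_unstable_weight_ge[OF pm \<alpha> _ un])
          show "0 < w e" if "e \<in> edges V" for e using that by (rule pos)
          show "w {u, v} \<le> w {a', b'}" if "unstable_edge \<alpha> V w M a' b'" for a' b'
            using that by (rule least)
          show "unstable_edge \<alpha> V w (flip_edges M u v) a b" using that(2) unfolding M'_def .
        qed
        moreover have "w f \<le> w {u, v}" using that(1) frozen[OF _ un] by (auto simp: F'_def)
        ultimately show ?thesis by simp
      qed
      show "0 \<le> W' g \<and> 0 < m' g \<and> w g \<le> W' g * m' g powr \<theta>" if "g \<in> M' - F'" for g
        using that Wm[of g] Wm1 Wm2 wxy xyR unfolding MF' MF(1) by (auto simp: W'_def m'_def)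
      have "cost w F' = w {u, v} + cost w F"
        using FM uv(4) finite_subset[OF FM finM] unfolding cost_def F'_def
        by (intro sum.insert) auto
      also have "\<dots> \<le> (\<Sum>g\<in>M' - F'. W' g * m' g powr \<theta>)"
        using costF merge sumR[of "\<lambda>a b. a * b powr \<theta>"] unfolding sumMF sumMF'
        by (simp add: W'_def m'_def)
      finally show "cost w F' \<le> (\<Sum>g\<in>M' - F'. W' g * m' g powr \<theta>)" .
    qed
    then show ?thesis unfolding sums .
  qed
qed

text \<open>The flips start from \<open>M\<close> with nothing frozen: every edge is a path of its
  own, with \<open>W = w\<close> and \<open>m = 1\<close>.\<close>

lemma stable_matching_cost_le:
  assumes mg: "metric_graph V w" and \<alpha>: "1 \<le> \<alpha>" and M: "perfect_matching V M"
  shows "\<exists>M'. stable_matching \<alpha> V w M' \<and>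
    cost w M' \<le> 2 * cost w M * real (card M) powr log 2 (1 + 1 / (2 * \<alpha>))"
proof -
  have pos: "0 < w e" if "e \<in> M" for e
    using that M mg perfect_matching_subset_edges
    by (auto simp: metric_graph_def weighted_complete_graph_def)
  show ?thesis
    using stable_matching_flip_induct[OF mg \<alpha> refl M, of "{}" w "\<lambda>_. 1"] pos
    by (auto simp: cost_def sum_nonneg less_imp_le)
qed

section \<open>From matchings to \<open>PoS_graph\<close>\<close>

lemma finite_stable_matchings: "finite V \<Longrightarrow> finite {M. stable_matching \<alpha> V w M}"
  by (rule finite_subset[OF _ finite_perfect_matchings]) (auto simp: stable_matching_def)

context
  fixes V :: "'a set" and w
  assumes mg: "metric_graph V w"
begin

lemma metric_graphD: "finite V" "V \<noteq> {}" "even (card V)" "\<And>e. e \<in> edges V \<Longrightarrow> 0 < w e"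
  using mg by (auto simp: metric_graph_def weighted_complete_graph_def)

lemma min_cost_pos: "0 < cost w (min_cost_matching V w)"
proof -
  have pm: "perfect_matching V (min_cost_matching V w)"
    using min_cost_matching_min(1) metric_graphD by blast
  have "min_cost_matching V w \<noteq> {}"
    using pm metric_graphD(2) by (auto simp: perfect_matching_iff)
  then show ?thesis
    unfolding cost_def
    using finite_perfect_matching[OF metric_graphD(1) pm] metric_graphD(4) perfect_matching_subset_edges[OF pm]
    by (intro sum_pos) auto
qed

lemma PoS_graph_le:
  assumes "1 \<le> \<alpha>"
  shows "PoS_graph \<alpha> V w \<le> 2 * real (card V div 2) powr log 2 (1 + 1 / (2 * \<alpha>))"
proof -
  let ?O = "min_cost_matching V w"
  have pm: "perfect_matching V ?O"
    using min_cost_matching_min(1) metric_graphD by blast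
  have "card ?O = card V div 2" using card_perfect_matching[OF metric_graphD(1) pm] by simp
  then obtain M where M: "stable_matching \<alpha> V w M"
      "cost w M \<le> 2 * cost w ?O * real (card V div 2) powr log 2 (1 + 1 / (2 * \<alpha>))"
    using stable_matching_cost_le[OF mg assms pm] by auto
  have "PoS_graph \<alpha> V w \<le> cost w M / cost w ?O"
    unfolding PoS_graph_def using M metric_graphD(1)
    by (intro Min_le finite_imageI finite_stable_matchings) auto
  also have "\<dots> \<le> 2 * real (card V div 2) powr log 2 (1 + 1 / (2 * \<alpha>))"
    using M min_cost_pos by (simp add: field_simps)
  finally show ?thesis .
qed

lemma PoS_graph_ge:
  assumes \<alpha>: "1 \<le> \<alpha>" and K: "perfect_matching V K" "cost w K \<le> B" and "0 \<le> A"
    and A: "\<And>M. stable_matching \<alpha> V w M \<Longrightarrow> A \<le> cost w M"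
  shows "A / B \<le> PoS_graph \<alpha> V w"
proof -
  let ?O = "min_cost_matching V w"
  have pm: "perfect_matching V ?O" and le: "cost w ?O \<le> B"
    using min_cost_matching_min[OF metric_graphD(1,3)] K by (auto intro: order_trans)
  \<comment> \<open>The flip process supplies a stable matching, so that \<open>Min\<close> ranges
    over a nonempty set.\<close>
  obtain M where M: "stable_matching \<alpha> V w M"
    using stable_matching_cost_le[OF mg \<alpha> pm] by auto
  show ?thesis
    unfolding PoS_graph_def
  proof (rule Min.boundedI)
    show "finite ((\<lambda>M. cost w M / cost w ?O) ` {M. stable_matching \<alpha> V w M})"
      using metric_graphD(1) by (intro finite_imageI finite_stable_matchings)
    show "(\<lambda>M. cost w M / cost w ?O) ` {M. stable_matching \<alpha> V w M} \<noteq> {}" using M by auto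
    fix r assume "r \<in> (\<lambda>M. cost w M / cost w ?O) ` {M. stable_matching \<alpha> V w M}"
    then obtain N where N: "stable_matching \<alpha> V w N" "r = cost w N / cost w ?O" by auto
    show "A / B \<le> r" unfolding N(2)
      using A[OF N(1)] le min_cost_pos \<open>0 \<le> A\<close> by (intro frac_le) auto
  qed
qed

end

subsection \<open>The line instance\<close>

text \<open>Induction on the rank \<open>r\<close>: vertices of smaller rank are already matched to
  their mates, so if \<open>u\<close> and \<open>p u\<close> are not matched to each other, both
  have partners of at least their own rank. By \<open>far\<close> both partners are so distant that
  \<open>{u, p u}\<close> is unstable.\<close>

lemma forced_edges:
  fixes r :: "'a \<Rightarrow> nat"
  assumes st: "stable_matching \<alpha> V w M"
    and p: "\<And>u. u \<in> V \<Longrightarrow> p u \<in> V \<and> p u \<noteq> u \<and> p (p u) = u \<and> r (p u) = r u"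
    and far: "\<And>u x. u \<in> V \<Longrightarrow> x \<in> V \<Longrightarrow> x \<noteq> u \<Longrightarrow> x \<noteq> p u \<Longrightarrow> r u \<le> r x \<Longrightarrow> \<alpha> * w {u, p u} < w {u, x}"
    and "u \<in> V"
  shows "{u, p u} \<in> M"
  using \<open>u \<in> V\<close>
proof (induction "r u" arbitrary: u rule: less_induct)
  case less
  have pm: "perfect_matching V M" using st by (simp add: stable_matching_def)
  have bad: "\<alpha> * w {v, p v} < w {v, partner M v}" if "v \<in> V" "r v = r u" "{v, p v} \<notin> M" for v
  proof (rule far)
    let ?x = "partner M v"
    show "v \<in> V" "?x \<in> V" "?x \<noteq> v"
      using that partner_in[OF pm] partner_neq[OF pm] by auto
    show "?x \<noteq> p v" using partner_edge[OF pm] that by metis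
    show "r v \<le> r ?x"
    proof (rule ccontr)
      assume "\<not> r v \<le> r ?x"
      \<comment> \<open>A partner of smaller rank is taken by its own mate, which would have to be
        \<open>v\<close>.\<close>
      then have "{?x, p ?x} \<in> M" using less.hyps[of ?x] that \<open>?x \<in> V\<close> by simp
      then have "p ?x = v"
        using partner_eq[OF pm] partner_partner[OF pm] that by metis
      then have "p v = ?x" using p[OF \<open>?x \<in> V\<close>] by auto
      with \<open>?x \<noteq> p v\<close> show False by simp
    qed
  qed
  show ?case
  proof (rule ccontr)
    assume nM: "{u, p u} \<notin> M"
    have pu: "p u \<in> V" "p u \<noteq> u" "p (p u) = u" "r (p u) = r u"
      using p[OF less.prems] by auto
    have "unstable_edge \<alpha> V w M u (p u)"
      using bad[of u] bad[of "p u"] nM pu less.prems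
      by (auto simp: unstable_edge_def insert_in_edges_iff insert_commute)
    then show False using st by (auto simp: stable_matching_def)
  qed
qed

section \<open>Points on a line with prescribed gaps\<close>

text \<open>The coordinate of point \<open>i\<close>, with point 0 at the origin; \<open>g l\<close>
  separates the points \<open>l - 1\<close> and \<open>l\<close>, so the sum starts at 1.\<close>

definition gap_sum :: "(nat \<Rightarrow> real) \<Rightarrow> nat \<Rightarrow> real" where
  "gap_sum g i = (\<Sum>l\<in>{1..i}. g l)"

lemma gap_sum_Suc [simp]: "gap_sum g (Suc i) = gap_sum g i + g (Suc i)"
  by (simp add: gap_sum_def)

text \<open>\<open>Max\<close> and \<open>Min\<close> recover the endpoints from an unordered pair.
  A singleton gets 0, in accordance with the distance of a point from itself.\<close>

definition line_weight :: "(nat \<Rightarrow> real) \<Rightarrow> nat set \<Rightarrow> real" where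
  "line_weight g e = gap_sum g (Max e) - gap_sum g (Min e)"

context
  fixes g :: "nat \<Rightarrow> real"
  assumes g_pos: "\<And>i. 0 < g i"
begin

lemma gap_sum_strict_mono: "strict_mono (gap_sum g)"
  using g_pos by (simp add: strict_mono_Suc_iff)

lemma gap_sum_mono: "a \<le> b \<Longrightarrow> gap_sum g a \<le> gap_sum g b"
  using gap_sum_strict_mono by (simp add: strict_mono_less_eq)

lemma gap_le: "a < i \<Longrightarrow> i \<le> b \<Longrightarrow> g i \<le> gap_sum g b - gap_sum g a"
  using gap_sum_mono[of a "i - 1"] gap_sum_mono[of i b] gap_sum_Suc[of g "i - 1"]
  by (cases i) auto

lemma line_weight_le: "a \<le> b \<Longrightarrow> line_weight g {a, b} = gap_sum g b - gap_sum g a"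
  by (simp add: line_weight_def)

lemma line_weight_abs: "line_weight g {a, b} = \<bar>gap_sum g a - gap_sum g b\<bar>"
  using gap_sum_mono[of a b] gap_sum_mono[of b a] by (simp add: line_weight_def max_def min_def)

lemma metric_graph_line_weight:
  assumes "finite V" "V \<noteq> {}" "even (card V)"
  shows "metric_graph V (line_weight g)"
proof (rule metric_graphI[OF assms])
  show "line_weight g {x, y} = \<bar>gap_sum g x - gap_sum g y\<bar>" for x y
    by (rule line_weight_abs)
  show "0 < \<bar>gap_sum g x - gap_sum g y\<bar>" if "x \<noteq> y" for x y
    using that strict_mono_eq[OF gap_sum_strict_mono] by simp
qed auto

end

text \<open>An aligned block of \<open>2 ^ Suc j\<close> points splits into two aligned blocks of
  \<open>2 ^ j\<close> points. The gap between them has index \<open>Suc (2 * q) * 2 ^ j\<close>, an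
  odd multiple of \<open>2 ^ j\<close>, hence length \<open>G j\<close>.\<close>

lemma gap_sum_block:
  assumes g: "\<And>i. 0 < i \<Longrightarrow> i < N \<Longrightarrow> g i = G (multiplicity 2 i)"
    and B: "B 0 = 0" "\<And>j. B (Suc j) = 2 * B j + G j"
    and "Suc q * 2 ^ j \<le> N"
  shows "gap_sum g (q * 2 ^ j + 2 ^ j - 1) - gap_sum g (q * 2 ^ j) = B j"
  using assms(4)
proof (induction j arbitrary: q)
  case 0
  then show ?case by (simp add: B)
next
  case (Suc j)
  \<comment> \<open>\<open>?s\<close> is the first point of the right half, so \<open>g ?s\<close>
    is the gap between the halves.\<close>
  let ?P = "2 ^ j :: nat" and ?s = "Suc (2 * q) * 2 ^ j :: nat"
  have le: "Suc (2 * q) * ?P \<le> N" "Suc (Suc (2 * q)) * ?P \<le> N" using Suc.prems by (auto simp: algebra_simps)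
  have P: "0 < ?P" by simp
  have "?s < Suc (Suc (2 * q)) * ?P" by simp
  then have "?s < N" using le(2) by linarith
  have "multiplicity 2 ?s = j"
    using multiplicity_prime_elem_times_other[of 2 "Suc (2 * q)" ] 
    by (subst prime_elem_multiplicity_mult_distrib) (auto simp: not_dvd_imp_multiplicity_0 multiplicity_same_power)
  then have gs: "g ?s = G j" using g[of ?s] \<open>?s < N\<close> by simp
  have e1: "?s + ?P - 1 = q * 2 ^ Suc j + 2 ^ Suc j - 1" and e2: "2 * q * ?P = q * 2 ^ Suc j"
    by (auto simp: algebra_simps)
  have "gap_sum g ?s = gap_sum g (?s - 1) + g ?s" using gap_sum_Suc[of g "?s - 1"] by simp
  moreover have "gap_sum g (?s - 1) - gap_sum g (2 * q * ?P) = B j"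
    using Suc.IH[of "2 * q"] le by (simp add: algebra_simps)
  moreover have "gap_sum g (?s + ?P - 1) - gap_sum g ?s = B j"
    using Suc.IH[of "Suc (2 * q)"] le by simp
  ultimately show ?case using B(2)[of j] unfolding gs e1 e2 by linarith
qed

text \<open>
  \<open>gap i\<close> is the distance from point \<open>i - 1\<close> to point \<open>i\<close>. \<open>B j\<close> is the length of a block of
  \<open>2 ^ j\<close> points and \<open>G j\<close> separates two such blocks. The points from \<open>N\<close> on are padding for \<open>n\<close>
  that are not powers of 2: unit pairs at large distance \<open>D\<close> from everything else. \<open>mate\<close> is the
  only \<open>\<alpha>\<close>-stable matching; its edges are forced in order of increasing \<open>rank\<close>.
\<close>

locale bad_line =
  fixes \<alpha> \<beta> :: real and n k :: nat
  assumes \<alpha>: "1 \<le> \<alpha>" and \<beta>: "0 < \<beta>" "\<alpha> * \<beta> < 1" and n: "2 ^ k \<le> n"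
begin

definition N :: nat where "N = 2 ^ Suc k"

fun G :: "nat \<Rightarrow> real" where
  "G 0 = 1"
| "G (Suc j) = \<beta> * (2 + \<beta>) ^ j"

fun B :: "nat \<Rightarrow> real" where
  "B 0 = 0"
| "B (Suc j) = (2 + \<beta>) ^ j"

text \<open>Large enough for both comparisons in \<open>D_greater\<close>: with a unit edge and with
  the length of the whole core, each multiplied by \<alpha>.\<close>

definition D :: real where "D = \<alpha> * (1 + B (Suc k)) + 1"

definition gap :: "nat \<Rightarrow> real" where
  "gap i = (if i < N then G (multiplicity 2 i) else if odd i then 1 else D)"

abbreviation pos :: "nat \<Rightarrow> real" where "pos \<equiv> gap_sum gap"

abbreviation wt :: "nat set \<Rightarrow> real" where "wt \<equiv> line_weight gap"

definition mate :: "nat \<Rightarrow> nat" where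
  "mate i = (if N \<le> i then if even i then Suc i else i - 1
     else if i = 0 then N - 1 else if i = N - 1 then 0 else if even i then i - 1 else Suc i)"

text \<open>For a core pair \<open>{i - 1, i}\<close> with \<open>i\<close> even this is the level
  of the gap between its points; padding pairs come first and the outermost pair last.\<close>

definition rank :: "nat \<Rightarrow> nat" where
  "rank i = (if N \<le> i then 0 else if i = 0 \<or> i = N - 1 then Suc k
     else multiplicity 2 (if even i then i else Suc i))"

lemma N_props: "even N" "2 \<le> N" "N \<le> 2 * n" "odd (N - 1)"
  using n by (auto simp: N_def)

text \<open>The closed forms solve this recursion because \<open>G j = \<beta> * B j\<close> for
  positive \<open>j\<close>, while \<open>G 0 = 1\<close> is the unit edge.\<close>

lemma B_Suc: "B (Suc j) = 2 * B j + G j"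
  by (cases j) (auto simp: algebra_simps)

lemma B_nonneg: "0 \<le> B j"
  using \<beta> by (cases j) auto

lemma G_pos: "0 < G j"
  using \<beta> by (cases j) auto

text \<open>Here \<open>\<alpha> * \<beta> < 1\<close> enters: a gap is shorter, by more than the
  factor \<alpha>, than the blocks on its two sides.\<close>

lemma G_less: "0 < j \<Longrightarrow> \<alpha> * G j < B j"
  using \<beta> mult_strict_right_mono[of "\<alpha> * \<beta>" 1 "(2 + \<beta>) ^ (j - 1)"] by (cases j) (auto simp: mult.assoc)

lemma D_greater: "\<alpha> * 1 < D" "\<alpha> * B (Suc k) < D"
proof -
  have "0 \<le> \<alpha> * B (Suc k)" using \<alpha> B_nonneg[of "Suc k"] by simp
  then show "\<alpha> * 1 < D" "\<alpha> * B (Suc k) < D"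
    using \<alpha> unfolding D_def distrib_left by linarith+
qed

lemma gap_pos: "0 < gap i"
  using G_pos D_greater(1) \<alpha> by (simp add: gap_def)

lemmas pos_mono = gap_sum_mono[of gap, OF gap_pos]
  and gap_le_pos = gap_le[of gap, OF gap_pos]
  and wt_abs = line_weight_abs[of gap, OF gap_pos]
  and wt_le = line_weight_le[of gap, OF gap_pos]

lemma gap_odd: "odd i \<Longrightarrow> gap i = 1"
  by (simp add: gap_def not_dvd_imp_multiplicity_0)

lemma pos_block: "Suc q * 2 ^ j \<le> N \<Longrightarrow> pos (q * 2 ^ j + 2 ^ j - 1) - pos (q * 2 ^ j) = B j"
  by (rule gap_sum_block[where N = N and G = G]) (auto simp: gap_def B_Suc simp del: B.simps(2))

lemma B_mono_Suc: "B j \<le> B (Suc j)"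
  using B_nonneg[of j] G_pos[of j] by (simp only: B_Suc)

lemma B_mono: "i \<le> j \<Longrightarrow> B i \<le> B j"
  by (rule lift_Suc_mono_le[of B]) (auto intro: B_mono_Suc simp del: B.simps)

lemma multiplicity_le_k: "0 < i \<Longrightarrow> i < N \<Longrightarrow> multiplicity 2 i \<le> k"
proof -
  assume i: "0 < i" "i < N"
  have "2 ^ multiplicity 2 i \<le> i" using i by (intro dvd_imp_le multiplicity_dvd) auto
  then have "(2::nat) ^ multiplicity 2 i < 2 ^ Suc k" using i unfolding N_def by linarith
  then show ?thesis by (simp add: del: power_Suc)
qed

text \<open>Describes each vertex by its \<open>mate\<close> edge. In the core case \<open>i\<close>
  is the right end of that edge, and so also the index of the gap between the two points.\<close>

lemma node_cases:
  obtains (extra) i where "even i" "N \<le> i" "u = i \<and> mate u = Suc i \<or> u = Suc i \<and> mate u = i"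
    | (outer) "u = 0 \<and> mate u = N - 1 \<or> u = N - 1 \<and> mate u = 0"
    | (core) i where "even i" "0 < i" "i < N" "rank u = multiplicity 2 i"
        "u = i \<and> mate u = i - 1 \<or> u = i - 1 \<and> mate u = i"
proof -
  consider "N \<le> u" "even u" | "N \<le> u" "odd u" | "u = 0 \<or> u = N - 1" | "u < N" "u \<noteq> 0" "u \<noteq> N - 1" "even u"
    | "u < N" "u \<noteq> 0" "u \<noteq> N - 1" "odd u"
    by linarith
  then show ?thesis
  proof cases
    case 1
    then show ?thesis using extra[of u] by (simp add: mate_def)
  next
    case 2
    then have "N \<le> u - 1" using N_props(1) by presburger
    then show ?thesis using extra[of "u - 1"] 2 by (simp add: mate_def)
  next
    case 3
    then show ?thesis using outer N_props by (auto simp: mate_def)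
  next
    case 4
    then show ?thesis using core[of u] by (simp add: mate_def rank_def)
  next
    case 5
    then show ?thesis using core[of "Suc u"] by (simp add: mate_def rank_def)
  qed
qed

lemma mate_props:
  assumes "u < 2 * n"
  shows "mate u < 2 * n" "mate u \<noteq> u" "mate (mate u) = u" "rank (mate u) = rank u"
proof -
  have "mate u < 2 * n \<and> mate u \<noteq> u \<and> mate (mate u) = u \<and> rank (mate u) = rank u"
  proof (cases u rule: node_cases)
    case (extra i)
    then have "Suc i < 2 * n" using assms by presburger
    then show ?thesis using extra by (auto simp: mate_def rank_def)
  next
    case outer
    then show ?thesis using N_props by (auto simp: mate_def rank_def)
  next
    case (core i)
    obtain l where l: "i = Suc (Suc (2 * l))"
      using core(1,2) by (metis evenE less_numeral_extra(3) mult_Suc_right not0_implies_Suc mult_0_right add_2_eq_Suc)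
    have "Suc (Suc (Suc (2 * l))) \<le> N" using core(3) l by simp
    moreover have "Suc (Suc (2 * l)) \<noteq> N - 1" using N_props(4) by (metis even_Suc even_mult_iff even_numeral)
    ultimately show ?thesis using core(5) N_props(3) unfolding l by (elim disjE conjE) (simp_all add: mate_def rank_def)
  qed
  then show "mate u < 2 * n" "mate u \<noteq> u" "mate (mate u) = u" "rank (mate u) = rank u" by blast+
qed

text \<open>A core point of rank at least \<open>j\<close> is the first or the last point of an
  aligned block of \<open>2 ^ j\<close> points. So a whole such block, of length \<open>B j\<close>,
  lies between \<open>x\<close> and the nearer point of the pair \<open>{i - 1, i}\<close>.\<close>

lemma far_core:
  assumes i: "0 < i" "i < N" and j: "j = multiplicity 2 i"
    and x: "x < N" "j \<le> rank x"
  shows "x < i - 1 \<Longrightarrow> B j \<le> pos (i - 1) - pos x"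
    and "i < x \<Longrightarrow> B j \<le> pos x - pos i"
proof -
  let ?P = "2 ^ j :: nat"
  have dN: "?P dvd N"
    using multiplicity_le_k[OF i] by (simp add: N_def j le_imp_power_dvd)
  obtain q where q: "i = q * ?P" using multiplicity_dvd[of 2 i] unfolding j by (metis dvdE mult.commute)
  then obtain q' where q': "q = Suc q'" using i(1) by (cases q) auto
  obtain Q where Q: "N = Q * ?P" using dN by (metis dvdE mult.commute)
  have "q * ?P < Q * ?P" using i(2) unfolding q[symmetric] Q[symmetric] .
  then have qQ: "Suc q \<le> Q" by simp
  have "x = 0 \<or> Suc x = N \<or> rank x = multiplicity 2 (if even x then x else Suc x)"
    using x(1) N_props(2) by (auto simp: rank_def)
  then have "?P dvd x \<or> ?P dvd Suc x"
  proof (elim disjE)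
    assume "rank x = multiplicity 2 (if even x then x else Suc x)"
    then have "?P dvd (if even x then x else Suc x)"
      using x(2) by (intro multiplicity_dvd') simp
    then show ?thesis by (cases "even x") auto
  qed (use dN in auto)
  then obtain t where t: "x = t * ?P \<or> Suc x = t * ?P" by (metis dvdE mult.commute)
  show "B j \<le> pos (i - 1) - pos x" if "x < i - 1"
  proof -
    have "t * ?P < q * ?P" using t that unfolding q[symmetric] by linarith
    then have "t < q" by simp
    then have "t * ?P \<le> q' * ?P" using q' by (intro mult_le_mono1) simp
    then have "x \<le> q' * ?P" using t by linarith
    moreover have "q' * ?P + ?P - 1 = i - 1" using q by (simp add: q')
    moreover have "Suc q' * ?P \<le> N" using i(2) unfolding q'[symmetric] q[symmetric] by simp
    ultimately show ?thesis using pos_block[of q' j] pos_mono[of x "q' * ?P"] by simp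
  qed
  show "B j \<le> pos x - pos i" if "i < x"
  proof -
    have "q * ?P < t * ?P" using t that unfolding q[symmetric] by linarith
    then have "Suc q * ?P \<le> t * ?P" by (intro mult_le_mono1) simp
    then have "q * ?P + ?P - 1 \<le> x" using t by auto
    moreover have "Suc q * ?P \<le> N" unfolding Q using qQ by (rule mult_le_mono1)
    ultimately show ?thesis using pos_block[of q j] pos_mono[of "q * ?P + ?P - 1" x] q by simp
  qed
qed

lemma wt_outer: "wt {0, N - 1} = B (Suc k)"
  using pos_block[of 0 "Suc k"] by (simp add: wt_le N_def)

text \<open>Supplies the separation required by \<open>forced_edges\<close>. A padding vertex is at
  distance at least \<open>D\<close> from all vertices but its mate, the core is at distance at
  least \<open>D\<close> from the padding, and inside the core \<open>far_core\<close> sets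
  \<open>B j\<close> against an edge of weight \<open>G j\<close>.\<close>

lemma far:
  assumes x: "x \<noteq> u" "x \<noteq> mate u" "rank u \<le> rank x"
  shows "\<alpha> * wt {u, mate u} < wt {u, x}"
proof -
  have core_extra: "D \<le> wt {a, b}" if "a < N" "N \<le> b" for a b
    using gap_le_pos[of a N b] that pos_mono[of a b] by (simp add: wt_abs gap_def N_props)
  have wt_pair: "wt {i, Suc i} = gap (Suc i)" for i
    using gap_pos[of "Suc i"] by (simp add: wt_abs)
  show ?thesis
  proof (cases u rule: node_cases)
    case (extra i)
    have "{u, mate u} = {i, Suc i}" using extra by auto
    then have w: "wt {u, mate u} = 1" using extra by (simp add: wt_pair gap_odd)
    have "x < i \<or> Suc i < x" using extra x by linarith
    then have "D \<le> wt {u, x}"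
    proof
      assume "x < i"
      then show ?thesis using gap_le_pos[of x i u] extra by (auto simp: wt_abs gap_def)
    next
      assume "Suc i < x"
      then show ?thesis using gap_le_pos[of u "Suc (Suc i)" x] extra by (auto simp: wt_abs gap_def)
    qed
    then show ?thesis using D_greater w by simp
  next
    case outer
    \<comment> \<open>Within the core only the two outermost points have rank
      \<open>Suc k\<close>.\<close>
    have "N \<le> x"
    proof (rule ccontr)
      assume "\<not> N \<le> x"
      then have "0 < x" "Suc x < N" "x < N" using x outer by auto
      then have "rank x \<le> k"
        using multiplicity_le_k[of x] multiplicity_le_k[of "Suc x"] by (auto simp: rank_def)
      moreover have "rank u = Suc k" using outer N_props by (auto simp: rank_def)
      ultimately show False using x(3) by simp
    qed
    moreover have "{u, mate u} = {0, N - 1}" "u < N" using outer N_props by auto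
    ultimately show ?thesis using core_extra[of u x] D_greater wt_outer by (simp del: B.simps)
  next
    case (core i)
    let ?j = "multiplicity 2 i"
    have j: "0 < ?j" using core by (simp add: prime_multiplicity_gt_zero_iff)
    have "{u, mate u} = {i - 1, Suc (i - 1)}" using core by auto
    then have "wt {u, mate u} = gap i" using wt_pair[of "i - 1"] core(2) by simp
    then have w: "wt {u, mate u} = G ?j" using core(3) by (simp add: gap_def)
    show ?thesis
    proof (cases "x < N")
      case True
      have rx: "?j \<le> rank x" using x(3) core(4) by simp
      have "x < i - 1 \<or> i < x" using core x by linarith
      then have "B ?j \<le> wt {u, x}"
      proof
        assume "x < i - 1"
        then show ?thesis
          using far_core(1)[OF core(2,3) refl True rx] pos_mono[of "i - 1" i] core(5) by (auto simp: wt_abs)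
      next
        assume "i < x"
        then show ?thesis
          using far_core(2)[OF core(2,3) refl True rx] pos_mono[of "i - 1" i] core(5) by (auto simp: wt_abs)
      qed
      then show ?thesis using G_less[OF j] w by simp
    next
      case False
      have "B ?j \<le> B (Suc k)" using multiplicity_le_k[OF core(2,3)] by (intro B_mono) simp
      also have "\<dots> \<le> \<alpha> * B (Suc k)"
        using mult_right_mono[OF \<alpha> B_nonneg[of "Suc k"]] by simp
      finally have "\<alpha> * G ?j < D" using G_less[OF j] D_greater(2) by linarith
      moreover have "u < N" using core by auto
      ultimately show ?thesis using core_extra[of u x] False w by simp
    qed
  qed
qed

text \<open>Gaps with odd index are 1, so pairing \<open>2 * i\<close> with
  \<open>Suc (2 * i)\<close> costs at most \<open>n\<close>. Every \<alpha>-stable matching contains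
  the edge between the outermost core points, whose weight is \<open>B (Suc k)\<close>.\<close>

lemma PoS_graph_line:
  "metric_graph {..<2 * n} wt"
  "(2 + \<beta>) ^ k / real n \<le> PoS_graph \<alpha> {..<2 * n} wt"
proof -
  have n0: "0 < n" using n by (metis gr0I le_zero_eq power_eq_0_iff zero_neq_numeral)
  show mg: "metric_graph {..<2 * n} wt"
    using n0 by (intro metric_graph_line_weight gap_pos) (auto simp: lessThan_empty_iff)
  let ?f = "\<lambda>i. {2 * i, Suc (2 * i)}"
  have K: "perfect_matching {..<2 * n} (?f ` {..<n})"
    unfolding perfect_matching_def
  proof (intro conjI ballI)
    show "?f ` {..<n} \<subseteq> edges {..<2 * n}" by (auto simp: insert_in_edges_iff)
    fix v assume "v \<in> {..<2 * n}"
    then show "\<exists>!e. e \<in> ?f ` {..<n} \<and> v \<in> e"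
      by (intro ex1I[of _ "?f (v div 2)"]) auto
  qed
  have "cost wt (?f ` {..<n}) \<le> (\<Sum>i<n. wt (?f i))"
    unfolding cost_def using sum_image_le[of "{..<n}" wt ?f] 
    by (auto simp: wt_abs)
  also have "\<dots> = real n" by (simp add: wt_abs gap_odd)
  finally have cK: "cost wt (?f ` {..<n}) \<le> real n" .
  have "(2 + \<beta>) ^ k \<le> cost wt M" if M: "stable_matching \<alpha> {..<2 * n} wt M" for M
  proof -
    have pm: "perfect_matching {..<2 * n} M" using M by (simp add: stable_matching_def)
    have "{0, mate 0} \<in> M"
      using n0 mate_props far by (intro forced_edges[OF M, where r = rank]) auto
    then have "wt {0, N - 1} \<le> cost wt M"
      unfolding cost_def using finite_perfect_matching[OF _ pm] N_props metric_graphD(4)[OF mg] perfect_matching_subset_edges[OF pm]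
      by (intro member_le_sum) (auto simp: mate_def intro: less_imp_le)
    moreover note wt_outer
    ultimately show ?thesis by simp
  qed
  then show "(2 + \<beta>) ^ k / real n \<le> PoS_graph \<alpha> {..<2 * n} wt"
    using \<beta> by (intro PoS_graph_ge[OF mg \<alpha> K cK]) auto
qed

end

section \<open>Asymptotics of \<open>PoS\<close>\<close>

lemma PoS_ge:
  assumes n1: "1 \<le> n" and \<alpha>: "1 \<le> \<alpha>"
  shows "ereal (1 / 6 * real n powr log 2 (1 + 1 / (2 * \<alpha>))) \<le> PoS \<alpha> (2 * n)"
proof -
  obtain k where k: "2 ^ k \<le> n" "n < 2 ^ (k + 1)"
    using ex_power_ivl1[of 2 n] n1 by auto
  \<comment> \<open>Small enough that \<open>(1 - \<epsilon>) ^ k \<ge> 1 / 2\<close> by Bernoulli's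
    inequality, so that keeping \<beta> below \<open>1 / \<alpha>\<close> costs only a factor
    2.\<close>
  define \<epsilon> where "\<epsilon> = 1 / (2 * (real k + 1))"
  define \<gamma> where "\<gamma> = 1 + 1 / (2 * \<alpha>)"
  define \<beta> where "\<beta> = (1 - \<epsilon>) / \<alpha>"
  have \<epsilon>: "0 < \<epsilon>" "\<epsilon> < 1" "real k * \<epsilon> \<le> 1 / 2" by (auto simp: \<epsilon>_def field_simps)
  have \<gamma>: "1 \<le> \<gamma>" "\<gamma> \<le> 3 / 2" using \<alpha> by (auto simp: \<gamma>_def field_simps)
  interpret bad_line \<alpha> \<beta> n k
    using \<alpha> \<epsilon> k by unfold_locales (auto simp: \<beta>_def)
  have n_le: "real n \<le> 2 ^ (k + 1)" using of_nat_mono[of n "2 ^ (k + 1)"] k(2) by simp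
  have "real n powr log 2 \<gamma> \<le> (2 ^ (k + 1)) powr log 2 \<gamma>"
    using n_le n1 \<gamma> by (intro powr_mono2) auto
  also have "\<dots> = \<gamma> ^ (k + 1)"
  proof -
    have "(2 ^ (k + 1)) powr log 2 \<gamma> = (2 powr log 2 \<gamma>) powr real (k + 1)"
      by (simp add: powr_powr mult.commute del: power_Suc of_nat_add of_nat_Suc flip: powr_realpow)
    then show ?thesis using \<gamma> by (simp add: powr_realpow del: of_nat_add of_nat_Suc)
  qed
  also have "\<dots> \<le> 3 / 2 * \<gamma> ^ k" using \<gamma> by (simp add: mult_right_mono)
  \<comment> \<open>The constant \<open>1 / 6\<close> is \<open>2 / 3 * (1 / 4)\<close>: the factor
    \<open>2 / 3\<close> absorbs the extra \<gamma> from rounding \<open>n\<close> up to a power of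
    2, and \<open>1 / 4\<close> absorbs the Bernoulli loss and \<open>n < 2 * 2 ^ k\<close>.\<close>
  finally have *: "1 / 6 * real n powr log 2 \<gamma> \<le> \<gamma> ^ k / 4" by simp
  have "1 / 2 \<le> (1 - \<epsilon>) ^ k"
    using Bernoulli_inequality[of "- \<epsilon>" k] \<epsilon> by simp
  then have "1 / 2 * (2 * \<gamma>) ^ k \<le> (1 - \<epsilon>) ^ k * (2 * \<gamma>) ^ k"
    using \<gamma> by (intro mult_right_mono) auto
  also have "\<dots> = ((1 - \<epsilon>) * (2 * \<gamma>)) ^ k" by (simp add: power_mult_distrib)
  also have "\<dots> \<le> (2 + \<beta>) ^ k"
  proof (rule power_mono)
    have "(1 - \<epsilon>) * (2 * \<gamma>) = 2 * (1 - \<epsilon>) + \<beta>"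
      using \<alpha> by (simp add: \<beta>_def \<gamma>_def field_simps)
    then show "(1 - \<epsilon>) * (2 * \<gamma>) \<le> 2 + \<beta>" using \<epsilon> by simp
    show "0 \<le> (1 - \<epsilon>) * (2 * \<gamma>)" using \<epsilon> \<gamma> by simp
  qed
  finally have "\<gamma> ^ k / 4 * 2 ^ (k + 1) \<le> (2 + \<beta>) ^ k" by (simp add: power_mult_distrib mult.commute)
  moreover have "\<gamma> ^ k / 4 * real n \<le> \<gamma> ^ k / 4 * 2 ^ (k + 1)"
    using n_le \<gamma> by (intro mult_left_mono) auto
  ultimately have "\<gamma> ^ k / 4 * real n \<le> (2 + \<beta>) ^ k" by linarith
  then have "\<gamma> ^ k / 4 \<le> (2 + \<beta>) ^ k / real n"
    using n1 by (subst pos_le_divide_eq) auto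
  with * PoS_graph_line(2) have "1 / 6 * real n powr log 2 \<gamma> \<le> PoS_graph \<alpha> {..<2 * n} wt" by linarith
  moreover have "ereal (PoS_graph \<alpha> {..<2 * n} wt) \<le> PoS \<alpha> (2 * n)"
    unfolding PoS_def using PoS_graph_line(1) by (intro Sup_upper) (auto intro!: exI)
  ultimately show ?thesis unfolding \<gamma>_def by (meson ereal_less_eq(3) order_trans)
qed

lemma PoS_le:
  assumes "1 \<le> \<alpha>"
  shows "PoS \<alpha> (2 * n) \<le> ereal (2 * real n powr log 2 (1 + 1 / (2 * \<alpha>)))"
  unfolding PoS_def
proof (rule Sup_least)
  fix z assume "z \<in> {ereal (PoS_graph \<alpha> V w) |(V :: nat set) w. metric_graph V w \<and> card V = 2 * n}"
  then show "z \<le> ereal (2 * real n powr log 2 (1 + 1 / (2 * \<alpha>)))"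
    using PoS_graph_le[OF _ assms] by fastforce
qed

theorem theorem4p1:
  shows "(\<exists>c C :: real. 0 < c \<and> c \<le> C \<and>
           (\<forall>n :: nat. \<forall>\<alpha> :: real. 1 \<le> n \<longrightarrow> 1 \<le> \<alpha> \<longrightarrow>
              ereal (c * real n powr log 2 (1 + 1 / (2 * \<alpha>))) \<le> PoS \<alpha> (2 * n) \<and>
              PoS \<alpha> (2 * n) \<le> ereal (C * real n powr log 2 (1 + 1 / (2 * \<alpha>))))) \<and>
         (\<exists>a :: nat \<Rightarrow> real. (\<forall>n. 1 \<le> a n) \<and> a \<in> O(\<lambda>n. ln (real n)) \<and>
           (\<exists>K :: real. \<forall>\<^sub>F n in sequentially. \<bar>PoS (a n) (2 * n)\<bar> \<le> ereal K))"
proof (intro conjI)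
  show "\<exists>c C :: real. 0 < c \<and> c \<le> C \<and>
           (\<forall>n :: nat. \<forall>\<alpha> :: real. 1 \<le> n \<longrightarrow> 1 \<le> \<alpha> \<longrightarrow>
              ereal (c * real n powr log 2 (1 + 1 / (2 * \<alpha>))) \<le> PoS \<alpha> (2 * n) \<and>
              PoS \<alpha> (2 * n) \<le> ereal (C * real n powr log 2 (1 + 1 / (2 * \<alpha>))))"
    using PoS_ge PoS_le by (intro exI[of _ "1 / 6"] exI[of _ 2]) auto
next
  \<comment> \<open>With \<alpha> of order \<open>ln n\<close> the exponent is of order
    \<open>1 / ln n\<close>, so the power of \<open>n\<close> stays bounded. The \<open>max\<close>
    covers \<open>n = 0\<close>.\<close>
  define a :: "nat \<Rightarrow> real" where "a n = 1 + ln (max 1 (real n))" for n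
  have a1: "1 \<le> a n" for n by (simp add: a_def)
  \<comment> \<open>From \<open>n = 3\<close> on the summand 1 of \<open>a n\<close> is absorbed by
    \<open>ln n\<close>, which gives the factor 2 below.\<close>
  have ln1: "1 \<le> ln (real n)" if "3 \<le> n" for n
  proof -
    have "exp 1 \<le> (3 :: real)" by (rule exp_le)
    then have "exp 1 \<le> real n" using that by linarith
    then show ?thesis using that by (simp add: ln_ge_iff)
  qed
  have "eventually (\<lambda>n. norm (a n) \<le> 2 * norm (ln (real n))) sequentially"
    using eventually_ge_at_top[of 3]
  proof eventually_elim
    case (elim n)
    then show ?case using ln1[OF elim] by (simp add: a_def)
  qed
  then have aO: "a \<in> O(\<lambda>n. ln (real n))" by (rule bigoI)
  have bound: "\<bar>PoS (a n) (2 * n)\<bar> \<le> ereal (2 * exp (1 / (2 * ln 2)))" if n: "1 \<le> n" for n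
  proof -
    \<comment> \<open>Uses \<open>ln (1 + x) \<le> x\<close>; afterwards
      \<open>ln n \<le> a n\<close> leaves the constant \<open>1 / (2 * ln 2)\<close>.\<close>
    have "log 2 (1 + 1 / (2 * a n)) * ln (real n) \<le> (1 / (2 * a n)) / ln 2 * ln (real n)"
      using ln_add_one_self_le_self[of "1 / (2 * a n)"] a1[of n] n
      unfolding log_def by (intro mult_right_mono divide_right_mono) auto
    also have "\<dots> = (ln (real n) / a n) * (1 / (2 * ln 2))" by (simp add: field_simps)
    also have "\<dots> \<le> 1 * (1 / (2 * ln 2))"
      using n by (intro mult_right_mono) (auto simp: a_def max_def divide_le_eq add_pos_nonneg)
    finally have "real n powr log 2 (1 + 1 / (2 * a n)) \<le> exp (1 / (2 * ln 2))"
      using n by (simp add: powr_def)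
    then have "PoS (a n) (2 * n) \<le> ereal (2 * exp (1 / (2 * ln 2)))"
      using PoS_le[OF a1, of n n] by (elim order_trans) simp
    \<comment> \<open>The lower bound gives nonnegativity, which settles the absolute value.\<close>
    moreover have "0 \<le> PoS (a n) (2 * n)"
      using PoS_ge[OF n a1, of n] by (elim order_trans[rotated]) simp
    ultimately show ?thesis by (simp add: ereal_abs_leI)
  qed
  have ev: "\<forall>\<^sub>F n in sequentially. \<bar>PoS (a n) (2 * n)\<bar> \<le> ereal (2 * exp (1 / (2 * ln 2)))"
    using eventually_ge_at_top[of 1] by (rule eventually_mono) (rule bound)
  show "\<exists>a :: nat \<Rightarrow> real. (\<forall>n. 1 \<le> a n) \<and> a \<in> O(\<lambda>n. ln (real n)) \<and>
           (\<exists>K :: real. \<forall>\<^sub>F n in sequentially. \<bar>PoS (a n) (2 * n)\<bar> \<le> ereal K)"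
    by (intro exI[of _ a] conjI allI exI[of _ "2 * exp (1 / (2 * ln 2))"] a1 aO ev)
qed

end
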